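(* Let $q$ be a prime power and let $n,k$ be integers with $1\le k\le n$. If $2k\ge n$, then $$\mathcal{C}_q(n,k,1)=q^{n-k}+1=\left\lceil \frac{q^n-1}{q^k-1}\right\rceil .$$
   Context: $\mathbb{F}_q$ is the finite field with $q$ elements, and for integers $n\ge k\ge 0$, $\mathcal{G}_q(n,k)$ denotes the set of all $k$-dimensional subspaces of $\mathbb{F}_q^n$. A $q$-covering design $C_q[n,k,r]$ is a collection $\mathbb{S}$ of elements of $\mathcal{G}_q(n,k)$ such that each element of $\mathcal{G}_q(n,r)$ is contained in at least one element of $\mathbb{S}$. The $q$-covering number $\mathcal{C}_q(n,k,r)$ is the minimum size of a $q$-covering design $C_q[n,k,r]$.
   Formalization: The equality with q^{n-k}+1 is claimed only for k<n, because for k=n the whole space alone is a covering, so the covering number and the ceiling are both 1 while q^{n-k}+1=2; the equality with the ceiling is claimed for all 1≤k≤n with 2k≥n. *)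

theory Defs
  imports "HOL-Analysis.Cartesian_Space" "HOL-Number_Theory.Prime_Powers"
begin

text \<open>
  The space \<open>\<bbbF>\<^sub>q\<^sup>n\<close> is the type \<open>'a ^ 'n\<close> with \<open>'a\<close> a finite field, \<open>q = CARD('a)\<close> and
  \<open>n = CARD('n)\<close>; \<open>vec.subspace\<close> and \<open>vec.dim\<close> are subspaces and dimension over \<open>'a\<close>.
\<close>

definition grassmannian :: "nat \<Rightarrow> ('a::{field,finite} ^ 'n) set set" where
  "grassmannian k = {V. vec.subspace V \<and> vec.dim V = k}"

definition q_covering_design :: "nat \<Rightarrow> nat \<Rightarrow> ('a::{field,finite} ^ 'n) set set \<Rightarrow> bool" where
  "q_covering_design k r \<S> \<longleftrightarrow>
     \<S> \<subseteq> grassmannian k \<and> (\<forall>U\<in>grassmannian r. \<exists>V\<in>\<S>. U \<subseteq> V)"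

text \<open>
  All designs are finite sets because \<open>'a ^ 'n\<close> is a finite type, so \<open>card\<close> is the genuine size.
  The minimum is over a nonempty set whenever \<open>r \<le> k \<le> CARD('n)\<close>; other parameters are
  not meaningful.
\<close>

definition q_covering_number ::
    "'a::{field,finite} itself \<Rightarrow> 'n::finite itself \<Rightarrow> nat \<Rightarrow> nat \<Rightarrow> nat" where
  "q_covering_number _ _ k r =
     (LEAST m. \<exists>\<S> :: ('a ^ 'n) set set. q_covering_design k r \<S> \<and> card \<S> = m)"

end

theory Submission
  imports Defs "HOL-Algebra.Algebraic_Closure_Type" "HOL-Number_Theory.Residues"
begin

text \<open>
  Let \<open>s = n - k\<close>, so that \<open>s \<le> k\<close>. A family of \<open>k\<close>-dimensional subspaces covers every line
  exactly when it covers every nonzero vector.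

  Lower bound: a \<open>k\<close>-dimensional subspace has \<open>q ^ k - 1\<close> nonzero vectors, so at least
  \<open>(q ^ n - 1) / (q ^ k - 1)\<close> subspaces are needed (\<open>point_covering_design_card_ge\<close>).
  For \<open>k < n\<close> this quotient equals \<open>q ^ s + (q ^ s - 1) / (q ^ k - 1)\<close>, and \<open>0 < s \<le> k\<close> puts
  the second summand into the half-open interval from \<open>0\<close> (excluded) to \<open>1\<close>, so the ceiling
  is \<open>q ^ s + 1\<close> (\<open>ceiling_power_ratio\<close>).

  Upper bound: take the lines of the affine plane over a field \<open>K\<close> of order \<open>q ^ s\<close> that pass
  through the origin, and pull them back to \<open>\<bbbF>\<^sub>q\<^sup>n\<close>. In detail, as \<open>2 * s \<le> n\<close>, there are two
  disjoint blocks of \<open>s\<close> coordinates, and each block can be read as one element of \<open>K\<close>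
  through a basis of \<open>K\<close> over \<open>\<bbbF>\<^sub>q\<close>. This gives two linear maps \<open>f\<close> and \<open>g\<close> to \<open>K\<close>. The
  \<open>q ^ s + 1\<close> subspaces \<open>{v. g v = x * f v}\<close>, for \<open>x \<in> K\<close>, and \<open>{v. f v = 0}\<close> cover everything,
  because \<open>v\<close> with \<open>f v \<noteq> 0\<close> lies in the one for \<open>x = g v / f v\<close>
  (\<open>ex_point_covering_design\<close>).

  The field \<open>K\<close> is the set of fixed points of \<open>x \<mapsto> x ^ (q ^ s)\<close> in the algebraic closure
  (\<open>ex_extension_field_alg_closure\<close>). All dimensions are found by counting: over \<open>\<bbbF>\<^sub>q\<close> a
  subspace has dimension \<open>d\<close> if and only if it has \<open>q ^ d\<close> elements.
  In the remaining case \<open>k = n\<close>, the whole space alone is a covering and the quotient is \<open>1\<close>.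
\<close>

\<comment> \<open>Here \<open>prime\<close>, \<open>order\<close> and \<open>degree\<close> are those of numbers and type-class polynomials, and
  \<open>$\<close> selects a vector component.\<close>
unbundle no fps_syntax
hide_const (open) Divisibility.prime Coset.order Polynomials.degree

section \<open>Counting in vector spaces\<close>

lemma (in vector_space) bij_betw_coordinates_span:
  assumes I: "finite I" and inj: "inj_on b I" and ind: "independent (b ` I)"
  shows "bij_betw (\<lambda>u. \<Sum>i\<in>I. scale (u i) (b i)) (I \<rightarrow>\<^sub>E UNIV) (span (b ` I))"
proof (rule bij_betw_imageI)
  show "inj_on (\<lambda>u. \<Sum>i\<in>I. scale (u i) (b i)) (I \<rightarrow>\<^sub>E UNIV)"
  proof (rule inj_onI)
    fix u v :: "_ \<Rightarrow> 'a"
    assume u: "u \<in> I \<rightarrow>\<^sub>E UNIV" and v: "v \<in> I \<rightarrow>\<^sub>E UNIV"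
      and eq: "(\<Sum>i\<in>I. scale (u i) (b i)) = (\<Sum>i\<in>I. scale (v i) (b i))"
    define w where "w x = (let i = inv_into I b x in u i - v i)" for x
    have "(\<Sum>x\<in>b ` I. scale (w x) x) = (\<Sum>i\<in>I. scale (u i - v i) (b i))"
      by (simp add: sum.reindex[OF inj] w_def inv_into_f_f[OF inj])
    also have "\<dots> = 0"
      using eq by (simp add: scale_left_diff_distrib sum_subtractf)
    finally have w0: "w x = 0" if "x \<in> b ` I" for x
      using independentD[OF ind] I that by blast
    have "u i = v i" if "i \<in> I" for i
      using w0[of "b i"] that by (simp add: w_def inv_into_f_f[OF inj])
    then show "u = v"
      using u v by (intro PiE_ext)
  qed
  show "(\<lambda>u. \<Sum>i\<in>I. scale (u i) (b i)) ` (I \<rightarrow>\<^sub>E UNIV) = span (b ` I)"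
  proof (intro equalityI subsetI)
    fix x assume "x \<in> span (b ` I)"
    then obtain w where "x = (\<Sum>y\<in>b ` I. scale (w y) y)"
      using I by (auto simp: span_finite)
    then have "x = (\<Sum>i\<in>I. scale (restrict (w \<circ> b) I i) (b i))"
      by (simp add: sum.reindex[OF inj])
    then show "x \<in> (\<lambda>u. \<Sum>i\<in>I. scale (u i) (b i)) ` (I \<rightarrow>\<^sub>E UNIV)"
      by (intro image_eqI[where x = "restrict (w \<circ> b) I"]) auto
  qed (auto intro: span_sum span_scale span_base)
qed

lemma (in vector_space) card_subspace:
  assumes "subspace S" "finite S"
  shows "card S = CARD('a) ^ dim S"
proof -
  obtain B where B: "B \<subseteq> S" "independent B" "S \<subseteq> span B" "card B = dim S"
    using basis_exists by blast
  have "finite B"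
    using B assms finite_subset by blast
  moreover have "span B = S"
    using B assms by (meson span_minimal subset_antisym)
  ultimately have "bij_betw (\<lambda>u. \<Sum>i\<in>B. scale (u i) i) (B \<rightarrow>\<^sub>E UNIV) S"
    using bij_betw_coordinates_span[of B id] B by simp
  then have "card (B \<rightarrow>\<^sub>E (UNIV :: 'a set)) = card S"
    by (rule bij_betw_same_card)
  then show ?thesis
    using B by (simp add: card_funcsetE[OF \<open>finite B\<close>])
qed

text \<open>
  The basis is indexed by a prescribed set of the right size. This is what turns a block of
  coordinates of \<open>\<bbbF>\<^sub>q\<^sup>n\<close> into a single element of a field extension.
\<close>

lemma (in vector_space) ex_coordinates_subspace:
  assumes "subspace S" "finite S" "finite (UNIV :: 'a set)"
    and I: "finite I" "card S = CARD('a) ^ card I"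
  shows "\<exists>b. bij_betw (\<lambda>u. \<Sum>i\<in>I. scale (u i) (b i)) (I \<rightarrow>\<^sub>E UNIV) S"
proof -
  obtain B where B: "B \<subseteq> S" "independent B" "S \<subseteq> span B" "card B = dim S"
    using basis_exists by blast
  have fB: "finite B"
    using B assms finite_subset by blast
  have span: "span B = S"
    using B assms by (meson span_minimal subset_antisym)
  have "card {0, 1 :: 'a} \<le> CARD('a)"
    by (intro card_mono assms) auto
  then have "CARD('a) > 1"
    by simp
  then have "card I = card B"
    using card_subspace[OF assms(1,2)] I B by (simp add: power_inject_exp)
  then obtain b where b: "bij_betw b I B"
    using finite_same_card_bij I fB by blast
  then have "b ` I = B" "inj_on b I"
    by (auto simp: bij_betw_def)
  then show ?thesis
    using bij_betw_coordinates_span[of I b] I B span by auto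
qed

text \<open>
  The equation determines the coordinates in \<open>J\<close> uniquely from the other ones, since \<open>h\<close> sees
  only the latter and \<open>\<phi>\<close> is bijective. The solution set is therefore the graph of a function of
  the coordinates outside \<open>J\<close>.
\<close>

lemma card_graph_coordinates:
  fixes h :: "('a::finite) ^ 'n \<Rightarrow> 'b"
  assumes bij: "bij_betw \<phi> (J \<rightarrow>\<^sub>E UNIV) K"
    and hK: "\<And>v. h v \<in> K"
    and h: "\<And>v w. (\<And>i. i \<notin> J \<Longrightarrow> v $ i = w $ i) \<Longrightarrow> h v = h w"
  shows "card {v. \<phi> (\<lambda>i\<in>J. v $ i) = h v} = CARD('a) ^ (CARD('n) - card J)"
proof -
  let ?V = "{v. \<phi> (\<lambda>i\<in>J. v $ i) = h v}"
  have "bij_betw (\<lambda>v. \<lambda>i\<in>-J. v $ i) ?V (-J \<rightarrow>\<^sub>E UNIV)"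
  proof (rule bij_betw_imageI)
    show "inj_on (\<lambda>v. \<lambda>i\<in>-J. v $ i) ?V"
    proof (rule inj_onI)
      fix v w
      assume v: "v \<in> ?V" and w: "w \<in> ?V"
        and "(\<lambda>i\<in>-J. v $ i) = (\<lambda>i\<in>-J. w $ i)"
      then have off: "v $ i = w $ i" if "i \<notin> J" for i
        using that by (metis ComplI restrict_apply')
      then have "h v = h w"
        by (rule h)
      then have "\<phi> (\<lambda>i\<in>J. v $ i) = \<phi> (\<lambda>i\<in>J. w $ i)"
        using v w by simp
      then have "(\<lambda>i\<in>J. v $ i) = (\<lambda>i\<in>J. w $ i)"
        using bij by (elim inj_onD[OF bij_betw_imp_inj_on]) auto
      then have "v $ i = w $ i" if "i \<in> J" for i
        using that by (metis restrict_apply')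
      with off show "v = w"
        by (auto simp: vec_eq_iff)
    qed
    show "(\<lambda>v. \<lambda>i\<in>-J. v $ i) ` ?V = (-J \<rightarrow>\<^sub>E UNIV)"
    proof (intro equalityI subsetI)
      fix u :: "'n \<Rightarrow> 'a" assume u: "u \<in> -J \<rightarrow>\<^sub>E UNIV"
      obtain t where t: "t \<in> J \<rightarrow>\<^sub>E UNIV" "\<phi> t = h (\<chi> i. u i)"
        using bij hK by (metis (no_types, lifting) bij_betw_imp_surj_on imageE)
      define v where "v = (\<chi> i. if i \<in> J then t i else u i)"
      have "(\<lambda>i\<in>J. v $ i) = t"
        using t by (intro PiE_ext[of _ J "\<lambda>_. UNIV"]) (auto simp: v_def)
      moreover have "h v = h (\<chi> i. u i)"
        by (rule h) (simp add: v_def)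
      moreover have "(\<lambda>i\<in>-J. v $ i) = u"
        using u by (intro PiE_ext[of _ "-J" "\<lambda>_. UNIV"]) (auto simp: v_def)
      ultimately show "u \<in> (\<lambda>v. \<lambda>i\<in>-J. v $ i) ` ?V"
        using t by (intro image_eqI[where x = v]) auto
    qed auto
  qed
  then have "card ?V = card (-J \<rightarrow>\<^sub>E (UNIV :: 'a set))"
    by (rule bij_betw_same_card)
  also have "\<dots> = CARD('a) ^ (CARD('n) - card J)"
    by (simp add: card_funcsetE Compl_eq_Diff_UNIV card_Diff_subset)
  finally show ?thesis .
qed

section \<open>Finite subfields of the algebraic closure\<close>

text \<open>
  With \<open>N\<close> the given power of the characteristic, the polynomial \<open>X ^ N - X\<close> splits into \<open>N\<close>
  linear factors. They are distinct because its derivative is the constant \<open>-1\<close>.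
\<close>

lemma card_fixed_points_frobenius_power:
  assumes "CHAR('a::alg_closed_field) > 0" and "j > 0"
  shows "card {x :: 'a. x ^ (CHAR('a) ^ j) = x} = CHAR('a) ^ j"
proof -
  define N where "N = CHAR('a) ^ j"
  have "prime CHAR('a)"
    using assms prime_CHAR_semidom by blast
  then have "CHAR('a) > 1"
    by (rule prime_gt_1_nat)
  then have N: "N > 1"
    using assms one_less_power unfolding N_def by blast
  have N0: "of_nat N = (0 :: 'a)"
    using assms by (simp add: N_def)
  define P :: "'a poly" where "P = monom 1 N - monom 1 1"
  have deg: "degree P = N"
    unfolding P_def diff_conv_add_uminus using N by (subst degree_add_eq_left) (auto simp: degree_monom_eq)
  have P: "P \<noteq> 0"
    using deg N by auto
  have roots: "{x. poly P x = 0} = {x. x ^ N = x}"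
    by (auto simp: P_def poly_monom)
  have pderiv: "pderiv P = -1"
    using N N0 by (simp add: P_def pderiv_diff pderiv_monom monom_eq_1 one_pCons)
  obtain A where A: "size A = N" "P = smult (lead_coeff P) (\<Prod>x\<in>#A. [:-x, 1:])"
    using alg_closed_imp_factorization[OF P] deg by metis
  have "proots P = proots (\<Prod>x\<in>#A. [:-x, 1:])"
    using P by (subst A(2)) (simp add: proots_smult)
  also have "\<dots> = A"
    by (induction A) (simp_all add: proots_mult prod_mset_zero_iff image_iff del: mult_pCons_left)
  finally have "proots P = A" .
  have le1: "order a P \<le> 1" for a
  proof (rule ccontr)
    assume "\<not> order a P \<le> 1"
    then have "[:-a, 1:] ^ 2 dvd P"
      using order_1[of a P] le_imp_power_dvd[of 2 "order a P" "[:-a, 1:]"] dvd_trans by fastforce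
    then obtain R where "P = [:-a, 1:] ^ 2 * R"
      by (elim dvdE)
    then have "P = [:-a, 1:] * ([:-a, 1:] * R)"
      by (simp only: power2_eq_square mult.assoc)
    then have "poly (pderiv P) a = 0"
      by (simp add: pderiv_mult del: mult_pCons_left)
    then show False
      by (simp add: pderiv)
  qed
  have eq1: "order a P = 1" if "poly P a = 0" for a
    using that P le1[of a] order_root[of P a] by linarith
  have "N = size (proots P)"
    using A \<open>proots P = A\<close> by simp
  also have "\<dots> = (\<Sum>x\<in>set_mset (proots P). order x P)"
    by (simp add: size_multiset_overloaded_eq P)
  also have "\<dots> = (\<Sum>x\<in>{x. poly P x = 0}. 1)"
    using P eq1 by (intro sum.cong) auto
  finally show ?thesis
    by (simp add: roots N_def)
qed

text \<open>
  Multiplication by a nonzero \<open>x\<close> permutes the nonzero elements, so it preserves their product.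
\<close>

lemma finite_field_power_CARD:
  fixes x :: "'a::{field,finite}"
  shows "x ^ CARD('a) = x"
proof (cases "x = 0")
  case False
  have "(\<Prod>y\<in>UNIV - {0}. y) = (\<Prod>y\<in>UNIV - {0}. x * y)"
    by (rule prod.reindex_bij_witness[of _ "\<lambda>y. x * y" "\<lambda>y. y / x"]) (use False in auto)
  also have "\<dots> = x ^ (CARD('a) - 1) * (\<Prod>y\<in>UNIV - {0}. y)"
    by (simp add: prod.distrib)
  finally have "x ^ (CARD('a) - 1) = 1"
    by simp
  then show ?thesis
    by (metis mult.right_neutral power_eq_if zero_less_card_finite less_numeral_extra(3))
qed simp

text \<open>
  The order of the field is a power of its characteristic. Hence the \<open>q ^ s\<close>-th power map is
  additive on the algebraic closure, as well as multiplicative, and its fixed points form a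
  subfield. That subfield contains the base field, whose elements satisfy \<open>a ^ q = a\<close>.
\<close>

lemma ex_extension_field_alg_closure:
  assumes "primepow CARD('a::{field,finite})" and "s > 0"
  obtains K :: "'a::{field,finite} alg_closure set"
  where "finite K" "card K = CARD('a) ^ s" "0 \<in> K"
    "\<And>x y. x \<in> K \<Longrightarrow> y \<in> K \<Longrightarrow> x + y \<in> K"
    "\<And>x y. x \<in> K \<Longrightarrow> y \<in> K \<Longrightarrow> x * y \<in> K"
    "\<And>x y. x \<in> K \<Longrightarrow> y \<in> K \<Longrightarrow> x / y \<in> K"
    "\<And>a. to_ac a \<in> K"
proof -
  let ?p = "CHAR('a alg_closure)"
  have "CHAR('a) > 0"
    by (rule finite_imp_CHAR_pos) simp
  then have pos: "?p > 0"
    by simp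
  then have prime: "prime ?p"
    using prime_CHAR_semidom by blast
  obtain r m where r: "prime r" "m > 0" "CARD('a) = r ^ m"
    using assms by (auto simp: primepow_def)
  have "?p dvd r ^ m"
    using CHAR_dvd_CARD[where ?'a = 'a] r by simp
  then have "?p = r"
    using prime r by (metis prime_dvd_power primes_dvd_imp_eq)
  then have q: "CARD('a) ^ s = ?p ^ (m * s)"
    using r by (simp add: power_mult)
  define K where "K = {x :: 'a alg_closure. x ^ (CARD('a) ^ s) = x}"
  have card: "card K = CARD('a) ^ s"
    unfolding K_def q using pos r assms by (intro card_fixed_points_frobenius_power) auto
  show thesis
  proof (rule that[of K])
    show "finite K"
      using card by (intro card_ge_0_finite) simp
    show "card K = CARD('a) ^ s"
      by fact
    show "0 \<in> K"
      by (simp add: K_def)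
    show "x + y \<in> K" if "x \<in> K" "y \<in> K" for x y
      using that freshmans_dream'[OF prime q, of x y] by (simp add: K_def)
    show "x * y \<in> K" if "x \<in> K" "y \<in> K" for x y
      using that by (simp add: K_def power_mult_distrib)
    show "x / y \<in> K" if "x \<in> K" "y \<in> K" for x y
      using that by (simp add: K_def power_divide)
    have "a ^ (CARD('a) ^ s) = a" for a :: 'a
      by (induction s) (simp_all add: finite_field_power_CARD power_mult)
    then show "to_ac a \<in> K" for a
      by (simp add: K_def flip: to_ac_power)
  qed
qed

section \<open>Point coverings\<close>

text \<open>
  A line is the span of any of its nonzero vectors, so a subspace contains the line as soon as it
  contains that vector.
\<close>

lemma point_covering_design_iff:
  fixes \<S> :: "('a::{field,finite} ^ 'n) set set"
  shows "q_covering_design k 1 \<S> \<longleftrightarrow> \<S> \<subseteq> grassmannian k \<and> (\<forall>v. v \<noteq> 0 \<longrightarrow> (\<exists>V\<in>\<S>. v \<in> V))"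
proof -
  have line: "vec.span {v} \<in> grassmannian 1" if "v \<noteq> 0" for v :: "'a ^ 'n"
    using that by (simp add: grassmannian_def vec.subspace_span vec.dim_eq_card_independent)
  have ex_line: "\<exists>v. v \<noteq> 0 \<and> U = vec.span {v}" if U: "U \<in> grassmannian 1" for U :: "('a ^ 'n) set"
  proof -
    obtain B where B: "B \<subseteq> U" "vec.independent B" "U \<subseteq> vec.span B" "card B = 1"
      using vec.basis_exists[of U] U by (auto simp: grassmannian_def)
    then obtain v where v: "B = {v}"
      by (auto simp: card_1_singleton_iff)
    have "vec.span {v} \<subseteq> U"
      using B U v by (intro vec.span_minimal) (auto simp: grassmannian_def)
    moreover have "v \<noteq> 0"
      using B(2) v by (simp add: vec.dependent_single)
    ultimately show ?thesis
      using B(3) v by blast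
  qed
  have span_subset: "vec.span {v} \<subseteq> V \<longleftrightarrow> v \<in> V" if "V \<in> grassmannian k" for v and V :: "('a ^ 'n) set"
    using that vec.span_minimal[of "{v}" V] vec.span_superset[of "{v}"]
    by (auto simp: grassmannian_def)
  show ?thesis
  proof (cases "\<S> \<subseteq> grassmannian k")
    case True
    have "(\<forall>U\<in>grassmannian 1. \<exists>V\<in>\<S>. U \<subseteq> V) \<longleftrightarrow>
        (\<forall>v. v \<noteq> 0 \<longrightarrow> (\<exists>V\<in>\<S>. vec.span {v} \<subseteq> V))"
      using line ex_line by blast
    also have "\<dots> \<longleftrightarrow> (\<forall>v. v \<noteq> 0 \<longrightarrow> (\<exists>V\<in>\<S>. v \<in> V))"
    proof -
      have "(\<exists>V\<in>\<S>. vec.span {v} \<subseteq> V) \<longleftrightarrow> (\<exists>V\<in>\<S>. v \<in> V)" for v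
        using True by (intro bex_cong refl span_subset) auto
      then show ?thesis
        by simp
    qed
    finally show ?thesis
      using True by (simp add: q_covering_design_def)
  qed (simp add: q_covering_design_def)
qed

lemma grassmannian_iff_card:
  fixes V :: "('a::{field,finite} ^ 'n) set"
  assumes "vec.subspace V"
  shows "V \<in> grassmannian k \<longleftrightarrow> card V = CARD('a) ^ k"
proof -
  have "card {0, 1 :: 'a} \<le> CARD('a)"
    by (intro card_mono) auto
  then show ?thesis
    using vec.card_subspace[OF assms] assms by (auto simp: grassmannian_def)
qed

lemma point_covering_design_card_ge:
  fixes \<S> :: "('a::{field,finite} ^ 'n) set set"
  assumes "q_covering_design k 1 \<S>"
  shows "CARD('a) ^ CARD('n) - 1 \<le> card \<S> * (CARD('a) ^ k - 1)"
proof -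
  have card: "card (V - {0}) = CARD('a) ^ k - 1" if "V \<in> \<S>" for V
  proof -
    from that have "V \<in> grassmannian k"
      using assms by (auto simp: q_covering_design_def)
    then have "vec.subspace V" "card V = CARD('a) ^ k"
      using grassmannian_iff_card by (auto simp: grassmannian_def)
    then show ?thesis
      by (simp add: vec.subspace_0 card_Diff_singleton)
  qed
  have "CARD('a) ^ CARD('n) - 1 = card (UNIV - {0 :: 'a ^ 'n})"
    by (simp add: card_Diff_singleton)
  also have "\<dots> \<le> card (\<Union>V\<in>\<S>. V - {0})"
    using assms unfolding point_covering_design_iff by (intro card_mono) auto
  also have "\<dots> \<le> (\<Sum>V\<in>\<S>. card (V - {0}))"
    by (rule card_UN_le) simp
  also have "\<dots> = card \<S> * (CARD('a) ^ k - 1)"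
    by (simp add: card)
  finally show ?thesis .
qed

text \<open>
  The members of the design are the preimages of the one-dimensional \<open>K\<close>-subspaces of \<open>K \<times> K\<close>
  under the map \<open>v \<mapsto> (f v, g v)\<close>. One of them is the vertical line, the others are given
  by their slope \<open>x\<close>. The map \<open>f\<close> reads the block \<open>I\<close> and \<open>g\<close> reads the block \<open>J\<close>. As the blocks
  are disjoint, \<open>x * f v\<close> depends only on coordinates outside \<open>J\<close>, so
  \<open>card_graph_coordinates\<close> yields the size \<open>q ^ (n - s) = q ^ k\<close> of the preimage of slope
  \<open>x\<close>. For the vertical line it applies with the block \<open>I\<close> and the zero function.
\<close>

lemma ex_point_covering_design:
  fixes k :: nat
  assumes pp: "primepow CARD('a::{field,finite})"
    and k: "k < CARD('n::finite)" "CARD('n) \<le> 2 * k"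
  shows "\<exists>\<S> :: ('a ^ 'n) set set. q_covering_design k 1 \<S> \<and> card \<S> \<le> CARD('a) ^ (CARD('n) - k) + 1"
proof -
  define s where "s = CARD('n) - k"
  have s: "s > 0" "s + s \<le> CARD('n)" "CARD('n) - s = k"
    using k by (auto simp: s_def)
  obtain K :: "'a alg_closure set" where K: "finite K" "card K = CARD('a) ^ s"
    and K0: "0 \<in> K"
    and K_add: "\<And>x y. x \<in> K \<Longrightarrow> y \<in> K \<Longrightarrow> x + y \<in> K"
    and K_mult: "\<And>x y. x \<in> K \<Longrightarrow> y \<in> K \<Longrightarrow> x * y \<in> K"
    and K_div: "\<And>x y. x \<in> K \<Longrightarrow> y \<in> K \<Longrightarrow> x / y \<in> K"
    and K_to_ac: "\<And>a. to_ac a \<in> K"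
    by (rule ex_extension_field_alg_closure[OF pp \<open>s > 0\<close>]) (rule that)
  interpret ac: vector_space "\<lambda>(a :: 'a) x. to_ac a * x"
    by standard (auto simp: algebra_simps)
  have subspace: "ac.subspace K"
    using K0 K_add K_mult K_to_ac by (auto simp: ac.subspace_def)
  obtain I :: "'n set" where I: "card I = s"
    using s ex_card[of s "UNIV :: 'n set"] by auto
  have "s \<le> card (-I)"
    using s I by (simp add: Compl_eq_Diff_UNIV card_Diff_subset)
  then obtain J where J: "J \<subseteq> -I" "card J = s"
    by (meson ex_card)
  have coord: "\<exists>b. bij_betw (\<lambda>u. \<Sum>i\<in>L. to_ac (u i) * b i) (L \<rightarrow>\<^sub>E UNIV) K"
    if "card L = s" for L :: "'n set"
    using that K by (intro ac.ex_coordinates_subspace subspace) auto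
  obtain b where b: "bij_betw (\<lambda>u. \<Sum>i\<in>I. to_ac (u i) * b i) (I \<rightarrow>\<^sub>E UNIV) K"
    using coord[OF I] by blast
  obtain c where c: "bij_betw (\<lambda>u. \<Sum>i\<in>J. to_ac (u i) * c i) (J \<rightarrow>\<^sub>E UNIV) K"
    using coord[OF J(2)] by blast
  define f where "f v = (\<Sum>i\<in>I. to_ac (v $ i) * b i)" for v :: "'a ^ 'n"
  define g where "g v = (\<Sum>i\<in>J. to_ac (v $ i) * c i)" for v :: "'a ^ 'n"
  have f_restrict: "(\<Sum>i\<in>I. to_ac ((\<lambda>i\<in>I. v $ i) i) * b i) = f v" for v
    by (simp add: f_def)
  have g_restrict: "(\<Sum>i\<in>J. to_ac ((\<lambda>i\<in>J. v $ i) i) * c i) = g v" for v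
    by (simp add: g_def)
  have fK: "f v \<in> K" for v
    using bij_betwE[OF b, rule_format, of "\<lambda>i\<in>I. v $ i"] unfolding f_restrict by simp
  have gK: "g v \<in> K" for v
    using bij_betwE[OF c, rule_format, of "\<lambda>i\<in>J. v $ i"] unfolding g_restrict by simp
  have f_lin: "f 0 = 0" "f (v + w) = f v + f w" "f (a *s v) = to_ac a * f v" for a v w
    by (simp_all add: f_def algebra_simps sum.distrib sum_distrib_left)
  have g_lin: "g 0 = 0" "g (v + w) = g v + g w" "g (a *s v) = to_ac a * g v" for a v w
    by (simp_all add: g_def algebra_simps sum.distrib sum_distrib_left)
  define W where "W x = {v. g v = x * f v}" for x
  define W_inf where "W_inf = {v. f v = 0}"
  have "W x \<in> grassmannian k" if "x \<in> K" for x
  proof -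
    have "vec.subspace (W x)"
      by (auto simp: vec.subspace_def W_def f_lin g_lin algebra_simps)
    moreover have "card (W x) = CARD('a) ^ (CARD('n) - card J)"
      unfolding W_def g_restrict[symmetric]
    proof (rule card_graph_coordinates[OF c])
      show "x * f v \<in> K" for v
        using that fK by (rule K_mult)
      fix v w :: "'a ^ 'n"
      assume "\<And>i. i \<notin> J \<Longrightarrow> v $ i = w $ i"
      then show "x * f v = x * f w"
        unfolding f_def using J by (intro arg_cong[of _ _ "(*) x"] sum.cong) auto
    qed
    ultimately show ?thesis
      using J s by (simp add: grassmannian_iff_card)
  qed
  moreover have "W_inf \<in> grassmannian k"
  proof -
    have "vec.subspace W_inf"
      by (auto simp: vec.subspace_def W_inf_def f_lin)
    moreover have "card W_inf = CARD('a) ^ (CARD('n) - card I)"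
      unfolding W_inf_def f_restrict[symmetric]
      using K0 by (intro card_graph_coordinates[OF b]) simp_all
    ultimately show ?thesis
      using I s by (simp add: grassmannian_iff_card)
  qed
  moreover have "\<exists>V\<in>insert W_inf (W ` K). v \<in> V" for v
  proof (cases "f v = 0")
    case False
    then have "v \<in> W (g v / f v)"
      by (simp add: W_def)
    moreover have "g v / f v \<in> K"
      using gK fK by (rule K_div)
    ultimately show ?thesis
      by blast
  qed (simp add: W_inf_def)
  ultimately have "q_covering_design k 1 (insert W_inf (W ` K))"
    unfolding point_covering_design_iff by auto
  moreover have "card (insert W_inf (W ` K)) \<le> CARD('a) ^ s + 1"
    using card_image_le[OF K(1), of W] K by (simp add: card_insert_if)
  ultimately show ?thesis
    unfolding s_def by blast
qed

lemma q_covering_number_leI: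
  fixes \<S> :: "('a::{field,finite} ^ 'n) set set"
  assumes "q_covering_design k r \<S>" "card \<S> \<le> m"
  shows "q_covering_number TYPE('a) TYPE('n) k r \<le> m"
proof -
  have "q_covering_number TYPE('a) TYPE('n) k r \<le> card \<S>"
    unfolding q_covering_number_def using assms(1) by (intro Least_le exI[of _ \<S>]) simp
  also have "\<dots> \<le> m"
    by fact
  finally show ?thesis .
qed

lemma q_covering_number_attained:
  fixes \<S> :: "('a::{field,finite} ^ 'n) set set"
  assumes "q_covering_design k r \<S>"
  obtains \<T> :: "('a ^ 'n) set set" where
    "q_covering_design k r \<T>" "card \<T> = q_covering_number TYPE('a) TYPE('n) k r"
proof -
  have "\<exists>\<T> :: ('a ^ 'n) set set. q_covering_design k r \<T> \<and>
      card \<T> = q_covering_number TYPE('a) TYPE('n) k r"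
    unfolding q_covering_number_def using assms
    by (intro LeastI[of "\<lambda>m. \<exists>\<T>. q_covering_design k r \<T> \<and> card \<T> = m" "card \<S>"]) blast
  then show ?thesis
    using that by blast
qed

lemma ceiling_power_ratio:
  fixes q n k :: nat
  assumes "q > 1" "k < n" "n \<le> 2 * k"
  shows "\<lceil>(real q ^ n - 1) / (real q ^ k - 1)\<rceil> = int (q ^ (n - k) + 1)"
proof -
  define s where "s = n - k"
  have s: "s > 0" "s \<le> k" "n = s + k"
    using assms by (auto simp: s_def)
  have "real q ^ s > 1" "real q ^ s \<le> real q ^ k"
    using assms s by (auto intro: one_less_power power_increasing)
  then have "real q ^ s < (real q ^ n - 1) / (real q ^ k - 1)"
    "(real q ^ n - 1) / (real q ^ k - 1) \<le> real q ^ s + 1"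
    by (simp_all add: s(3) power_add field_simps)
  then show ?thesis
    unfolding s_def[symmetric] by (intro ceiling_unique) simp_all
qed

theorem theorem6:
  fixes q n k :: nat
  assumes "primepow q"
    and "CARD('a::{field,finite}) = q"
    and "CARD('n::finite) = n"
    and "1 \<le> k" and "k \<le> n"
    and "2 * k \<ge> n"
  shows "int (q_covering_number TYPE('a) TYPE('n) k 1) =
           \<lceil>(real q ^ n - 1) / (real q ^ k - 1)\<rceil> \<and>
         (k < n \<longrightarrow> q_covering_number TYPE('a) TYPE('n) k 1 = q ^ (n - k) + 1)"
proof -
  let ?C = "q_covering_number TYPE('a) TYPE('n) k 1"
  have q: "q > 1"
    using assms by (simp add: primepow_gt_Suc_0)
  have qk: "q ^ k > 1"
    using q assms by (intro one_less_power) auto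
  have lower: "\<lceil>(real q ^ n - 1) / (real q ^ k - 1)\<rceil> \<le> int ?C"
    if "q_covering_design k 1 \<S>" for \<S> :: "('a ^ 'n) set set"
  proof -
    obtain \<T> :: "('a ^ 'n) set set" where "q_covering_design k 1 \<T>" "card \<T> = ?C"
      using q_covering_number_attained \<open>q_covering_design k 1 \<S>\<close> by blast
    then have "q ^ n - 1 \<le> ?C * (q ^ k - 1)"
      using point_covering_design_card_ge assms by metis
    then have "real (q ^ n - 1) \<le> real (?C * (q ^ k - 1))"
      by (rule of_nat_mono)
    then have "real q ^ n - 1 \<le> real ?C * (real q ^ k - 1)"
      using q by (simp add: of_nat_diff)
    moreover have "real q ^ k > 1"
      using qk by (metis of_nat_1 of_nat_less_iff of_nat_power)
    ultimately show ?thesis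
      by (simp add: ceiling_le_iff divide_le_eq)
  qed
  show ?thesis
  proof (cases "k < n")
    case True
    obtain \<S> :: "('a ^ 'n) set set" where
      \<S>: "q_covering_design k 1 \<S>" "card \<S> \<le> q ^ (n - k) + 1"
      using ex_point_covering_design[where ?'a = 'a and ?'n = 'n, of k] assms True by auto
    have "?C \<le> q ^ (n - k) + 1"
      using \<S> by (rule q_covering_number_leI)
    moreover have "\<lceil>(real q ^ n - 1) / (real q ^ k - 1)\<rceil> = int (q ^ (n - k) + 1)"
      using q True assms by (intro ceiling_power_ratio) auto
    ultimately show ?thesis
      using lower[OF \<S>(1)] by linarith
  next
    case False
    then have "k = n"
      using assms by simp
    have "(UNIV :: ('a ^ 'n) set) \<in> grassmannian k"
      using assms \<open>k = n\<close> by (simp add: grassmannian_iff_card)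
    then have U: "q_covering_design k 1 {UNIV :: ('a ^ 'n) set}"
      unfolding point_covering_design_iff by auto
    have "?C \<le> 1"
      using U by (rule q_covering_number_leI) simp
    moreover have "real q ^ n > 1"
      using qk \<open>k = n\<close> by (metis of_nat_1 of_nat_less_iff of_nat_power)
    then have "\<lceil>(real q ^ n - 1) / (real q ^ k - 1)\<rceil> = 1"
      using \<open>k = n\<close> by simp
    ultimately show ?thesis
      using lower[OF U] False by linarith
  qed
qed

end
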